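(* For every integer $p \ge 0$ and every real $\nu \in [0,1]$, $$H_{p,\nu} \le \prod_{i=1}^p (\nu+i),$$ where $$H_{p,\nu} := \sup_{0 \le \tau_1 < \tau_2 \le 1} \frac{g_{p,p+\nu}(\tau_2) - g_{p,p+\nu}(\tau_1)}{(\tau_2-\tau_1)^\nu}$$ is the $\nu$-Hölder constant of the polynomial $g_{p,p+\nu}$ on $[0,1]$.
   Context: The polynomials $g_{p,q} : \mathbb{R} \to \mathbb{R}$ (integer $p \ge 0$, real $q$) are defined recursively by $g_{0,q}(\tau) := 1$ and, for $p \ge 1$, $g_{p,q}(\tau) := (1-\tau^2)\, g_{p-1,q}'(\tau) + (q-p+1)\,\tau\, g_{p-1,q}(\tau)$, where the prime denotes differentiation in $\tau$. Empty products equal $1$. No absolute value is needed in the numerator defining $H_{p,\nu}$ because $g_{p,p+\nu}$ is nondecreasing on $[0,1]$. *)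

theory Defs
  imports "HOL-Analysis.Analysis" "HOL-Library.Extended_Real"
begin

primrec g :: "nat \<Rightarrow> real \<Rightarrow> real \<Rightarrow> real" where
  "g 0 q = (\<lambda>\<tau>. 1)"
| "g (Suc p) q =
     (\<lambda>\<tau>. (1 - \<tau>\<^sup>2) * deriv (g p q) \<tau> + (q - real (Suc p) + 1) * \<tau> * g p q \<tau>)"

text \<open>
  The supremum is taken in the extended reals, so that an upper bound on it really bounds every
  difference quotient (the supremum of an unbounded set of reals is unspecified). The base of
  the power is positive, so the denominator is 1 when the exponent is 0.
\<close>

definition H :: "nat \<Rightarrow> real \<Rightarrow> ereal" where
  "H p \<nu> =
     (SUP (\<tau>\<^sub>1, \<tau>\<^sub>2) \<in> {(\<tau>\<^sub>1, \<tau>\<^sub>2). 0 \<le> \<tau>\<^sub>1 \<and> \<tau>\<^sub>1 < \<tau>\<^sub>2 \<and> \<tau>\<^sub>2 \<le> 1}.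
        ereal ((g p (real p + \<nu>) \<tau>\<^sub>2 - g p (real p + \<nu>) \<tau>\<^sub>1) / (\<tau>\<^sub>2 - \<tau>\<^sub>1) powr \<nu>))"

end

theory Submission
  imports Defs
begin

text \<open>
  Write \<open>y\<close> for \<open>g p (p + \<nu>)\<close> and \<open>K\<close> for \<open>y 1\<close>. The product on the right of the theorem is \<open>K\<close>, so
  the claim is that \<open>y t - y s \<le> K * (t - s) powr \<nu>\<close> for \<open>0 \<le> s < t \<le> 1\<close>: the pair \<open>(0, 1)\<close> already
  gives the constant, up to the term \<open>y 0 \<ge> 0\<close>.

  The polynomials are, up to normalization, Gegenbauer polynomials with a negative parameter, and
  \<open>y\<close> solves the linear equation \<open>(1 - x\<^sup>2) y'' + (p + \<nu> - 1) x y' = p \<nu> y\<close> (lemma \<open>g_ode\<close>). The sign of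
  \<open>y''\<close> depends on the parity of \<open>p\<close>, but the estimate can be read off the equation without knowing
  it, by a maximum principle in two variables (lemma \<open>holder_of_ode\<close>). Suppose that
  \<open>\<Phi> (s, t) = y t - y s - K (t - s) powr \<nu>\<close> has a positive maximum, and put \<open>\<delta> = t - s\<close>. At an
  interior maximum, \<open>y' s\<close> and \<open>y' t\<close> both equal \<open>\<kappa> = K \<nu> \<delta> powr (\<nu> - 1)\<close>, and concavity of
  the power gives \<open>y'' t \<le> 0 \<le> y'' s\<close>. Subtracting the equations at \<open>s\<close> and \<open>t\<close> yields
  \<open>p \<nu> (y t - y s) \<le> (p + \<nu> - 1) \<kappa> \<delta> \<le> p \<nu> K \<delta> powr \<nu>\<close>, contrary to \<open>\<Phi> (s, t) > 0\<close>. On the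
  side \<open>s = 0\<close> the inequality drawn from the equation at \<open>s\<close> is just \<open>y 0 \<ge> 0\<close>, and on the side
  \<open>t = 1\<close> the known value \<open>y 1 = K\<close> and a Bernoulli inequality for \<open>\<delta> powr (1 - \<nu>)\<close> replace the
  equation at \<open>t\<close>.

  The argument divides by \<open>p \<nu>\<close>. For \<open>\<nu> = 0\<close> the equation has first order in \<open>y'\<close>, so \<open>y'\<close> keeps
  the sign of \<open>y' 0 \<ge> 0\<close>, and the increasing function \<open>y\<close> varies by at most \<open>y 1 - y 0 \<le> K\<close>
  (lemma \<open>increasing_of_ode\<close>); for \<open>p = 0\<close> it is constant.
\<close>

section \<open>The polynomials and their differential equation\<close>

lemma g_polynomial: "\<exists>P. g n q = poly P"
proof (induction n)
  case 0
  show ?case by (intro exI[of _ 1]) auto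
next
  case (Suc n)
  then obtain P where P: "g n q = poly P" by blast
  have "deriv (poly P) = poly (pderiv P)"
    by (rule ext) (simp add: DERIV_imp_deriv)
  then have "g (Suc n) q = poly ([:1, 0, -1:] * pderiv P + smult (q - real n) ([:0, 1:] * P))"
    by (auto simp: P fun_eq_iff algebra_simps power2_eq_square)
  then show ?case by blast
qed

text \<open>
  The function \<open>deriv\<close> returns an unspecified value where there is no derivative, so the recursion
  for \<open>g\<close> has its intended meaning only because every \<open>g n q\<close> is a polynomial.
\<close>

lemma g_DERIV: "(g n q has_real_derivative deriv (g n q) x) (at x)"
  and g_DERIV2: "(deriv (g n q) has_real_derivative deriv (deriv (g n q)) x) (at x)"
proof -
  obtain P where P: "g n q = poly P" using g_polynomial by blast
  have D: "deriv (poly P) = poly (pderiv P)" for P :: "real poly"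
    by (rule ext) (simp add: DERIV_imp_deriv)
  show "(g n q has_real_derivative deriv (g n q) x) (at x)"
    "(deriv (g n q) has_real_derivative deriv (deriv (g n q)) x) (at x)"
    by (simp_all add: P D)
qed

lemma g_Suc: "g (Suc n) q x = (1 - x\<^sup>2) * deriv (g n q) x + (q - real n) * x * g n q x"
  by simp

text \<open>
  Differentiating the recursion produces a second derivative, which the equation for \<open>g n q\<close>
  eliminates. The derivative of \<open>g (Suc n) q\<close> is then again a first-order expression in \<open>g n q\<close>;
  this is what makes the induction for the equation close.
\<close>

lemma deriv_g_Suc_of_ode:
  assumes "(1 - x\<^sup>2) * deriv (deriv (g n q)) x + (q - 1) * x * deriv (g n q) x
             + real n * (real n - q) * g n q x = 0"
  shows "deriv (g (Suc n) q) x = (real n + 1) * ((q - real n) * g n q x - x * deriv (g n q) x)"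
proof -
  have "(g (Suc n) q has_real_derivative
          (1 - x\<^sup>2) * deriv (deriv (g n q)) x - 2 * x * deriv (g n q) x
          + (q - real n) * (g n q x + x * deriv (g n q) x)) (at x)"
    unfolding g.simps
    by (auto intro!: derivative_eq_intros g_DERIV g_DERIV2 simp: algebra_simps)
  then have "deriv (g (Suc n) q) x = (1 - x\<^sup>2) * deriv (deriv (g n q)) x - 2 * x * deriv (g n q) x
          + (q - real n) * (g n q x + x * deriv (g n q) x)"
    by (rule DERIV_imp_deriv)
  then show ?thesis using assms by algebra
qed

text \<open>
  For \<open>q = -2 \<lambda>\<close> this is Gegenbauer's equation: \<open>g n q x\<close> is the \<open>n\<close>-th derivative at \<open>r = 0\<close> of
  \<open>(1 + 2 x r + r\<^sup>2) powr (q / 2)\<close>.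
\<close>

lemma g_ode:
  "(1 - x\<^sup>2) * deriv (deriv (g n q)) x + (q - 1) * x * deriv (g n q) x
     + real n * (real n - q) * g n q x = 0"
proof (induction n arbitrary: x)
  case 0
  show ?case by simp
next
  case (Suc n)
  have D1: "deriv (g (Suc n) q) = (\<lambda>x. (real n + 1) * ((q - real n) * g n q x - x * deriv (g n q) x))"
    using deriv_g_Suc_of_ode[OF Suc.IH] by blast
  have "(deriv (g (Suc n) q) has_real_derivative
          (real n + 1) * ((q - real n - 1) * deriv (g n q) x - x * deriv (deriv (g n q)) x)) (at x)"
    unfolding D1
    by (auto intro!: derivative_eq_intros g_DERIV g_DERIV2 simp: algebra_simps)
  then have D2: "deriv (deriv (g (Suc n) q)) x
      = (real n + 1) * ((q - real n - 1) * deriv (g n q) x - x * deriv (deriv (g n q)) x)"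
    by (rule DERIV_imp_deriv)
  show ?case
    unfolding D2 unfolding fun_cong[OF D1] unfolding g_Suc of_nat_Suc using Suc.IH[of x] by algebra
qed

lemmas deriv_g_Suc = deriv_g_Suc_of_ode[OF g_ode]

lemma g_at_1: "g n q 1 = (\<Prod>i<n. q - real i)"
  by (induction n) auto

lemma g_shifted_at_1: "g p (real p + \<nu>) 1 = (\<Prod>i = 1..p. \<nu> + real i)"
proof -
  have "(\<Prod>i<p. real p + \<nu> - real i) = (\<Prod>i = 1..p. \<nu> + real i)"
    by (rule prod.reindex_bij_witness[of _ "\<lambda>i. p - i" "\<lambda>i. p - i"]) auto
  then show ?thesis by (simp add: g_at_1)
qed

text \<open>
  At \<open>0\<close> the recursion and the formula for the derivative swap the two values up to the factor
  \<open>(n + 1) (q - n)\<close>, so both signs have to be carried through the induction together.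
\<close>

lemma g_at_0_nonneg:
  assumes "real n \<le> q"
  shows "0 \<le> g n q 0" and "0 \<le> deriv (g n q) 0"
proof -
  have "0 \<le> g n q 0 \<and> 0 \<le> deriv (g n q) 0"
    using assms
  proof (induction n)
    case (Suc n)
    then show ?case by (simp add: deriv_g_Suc del: g.simps) (simp add: g_Suc)
  qed simp
  then show "0 \<le> g n q 0" and "0 \<le> deriv (g n q) 0" by auto
qed

section \<open>A two-point maximum principle\<close>

lemma local_max_derivs:
  fixes f :: "real \<Rightarrow> real"
  assumes t: "a < t" "t < b"
    and max: "\<And>x. a < x \<Longrightarrow> x < b \<Longrightarrow> f x \<le> f t"
    and f': "\<And>x. a < x \<Longrightarrow> x < b \<Longrightarrow> (f has_real_derivative f' x) (at x)"
    and f'': "(f' has_real_derivative l) (at t)"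
  shows "f' t = 0" and "l \<le> 0"
proof -
  show zero: "f' t = 0"
  proof (rule DERIV_local_max[OF f'[OF t], of "min (t - a) (b - t)"])
    show "0 < min (t - a) (b - t)" using t by simp
    show "\<forall>y. \<bar>t - y\<bar> < min (t - a) (b - t) \<longrightarrow> f y \<le> f t"
      using max by (auto simp: abs_if split: if_splits)
  qed
  show "l \<le> 0"
  proof (rule ccontr)
    assume "\<not> l \<le> 0"
    then obtain d where d: "d > 0" "\<And>h. h > 0 \<Longrightarrow> h < d \<Longrightarrow> f' t < f' (t + h)"
      using DERIV_pos_inc_right[OF f''] by auto
    define h where "h = min d (b - t) / 2"
    have h: "0 < h" "h < d" "t + h < b" using d(1) t by (auto simp: h_def min_def field_simps)
    have "f t < f (t + h)"
    proof (rule DERIV_pos_imp_increasing_open[of t "t + h" f])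
      show "t < t + h" using h by simp
      fix x assume x: "t < x" "x < t + h"
      have "f' x > 0" using d(2)[of "x - t"] x h zero by simp
      then show "\<exists>y. (f has_real_derivative y) (at x) \<and> 0 < y"
        using f'[of x] x h t by auto
    next
      show "continuous_on {t..t + h} f"
        using DERIV_isCont[OF f'] h t by (auto intro!: continuous_at_imp_continuous_on)
    qed
    then show False using max[of "t + h"] h t by simp
  qed
qed

text \<open>
  The integer \<open>p\<close> enters the argument only through the coefficients of the equation, so it becomes a
  real number \<open>a \<ge> 1\<close>.
\<close>

lemma holder_of_ode:
  fixes y y' y'' :: "real \<Rightarrow> real" and a \<nu> :: real
  assumes \<nu>: "0 < \<nu>" "\<nu> \<le> 1" and a: "1 \<le> a"
    and y': "\<And>x. (y has_real_derivative y' x) (at x)"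
    and y'': "\<And>x. (y' has_real_derivative y'' x) (at x)"
    and ode: "\<And>x. (1 - x\<^sup>2) * y'' x + (a + \<nu> - 1) * x * y' x = a * \<nu> * y x"
    and y0: "0 \<le> y 0" and y1: "0 \<le> y 1"
    and st: "0 \<le> s" "s \<le> t" "t \<le> 1"
  shows "y t - y s \<le> y 1 * (t - s) powr \<nu>"
proof (rule ccontr)
  assume neg: "\<not> ?thesis"
  define K where "K = y 1"
  define \<Phi> where "\<Phi> = (\<lambda>(s, t). y t - y s - K * (t - s) powr \<nu>)"
  define T where "T = {(s, t). 0 \<le> s \<and> s \<le> t \<and> t \<le> (1::real)}"
  have "T = ({0..1} \<times> {0..1}) \<inter> {z. fst z \<le> snd z}"
    unfolding T_def by auto
  moreover have "closed {z :: real \<times> real. fst z \<le> snd z}"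
    by (intro closed_Collect_le continuous_intros)
  ultimately have compact: "compact T"
    by (simp add: compact_Int_closed compact_Times)
  have cont_y: "continuous_on A y" for A
    using DERIV_isCont[OF y'] by (simp add: continuous_at_imp_continuous_on)
  have "continuous_on T (\<lambda>z. (snd z - fst z) powr \<nu>)"
  proof (rule continuous_on_powr')
    show "continuous_on T (\<lambda>z. snd z - fst z)" "continuous_on T (\<lambda>z. \<nu>)"
      by (intro continuous_intros)+
    show "\<forall>z\<in>T. 0 \<le> snd z - fst z \<and> (snd z - fst z = 0 \<longrightarrow> 0 < \<nu>)"
      using \<nu> by (auto simp: T_def)
  qed
  moreover have "continuous_on T (\<lambda>z. y (fst z))" "continuous_on T (\<lambda>z. y (snd z))"
    using continuous_on_compose2[OF cont_y[of UNIV], of T fst]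
      continuous_on_compose2[OF cont_y[of UNIV], of T snd] by (simp_all add: continuous_intros)
  ultimately have "continuous_on T \<Phi>"
    unfolding \<Phi>_def case_prod_beta by (intro continuous_on_diff continuous_on_mult continuous_on_const)
  moreover have "T \<noteq> {}" using st by (auto simp: T_def)
  ultimately obtain z where z: "z \<in> T" "\<And>w. w \<in> T \<Longrightarrow> \<Phi> w \<le> \<Phi> z"
    using continuous_attains_sup[OF compact] by blast
  obtain u v where uv: "z = (u, v)" by fastforce
  have max: "\<Phi> (x, x') \<le> \<Phi> (u, v)" if "0 \<le> x" "x \<le> x'" "x' \<le> 1" for x x'
    using z(2)[of "(x, x')"] that by (auto simp: uv T_def)
  have pos: "0 < \<Phi> (u, v)"
    using neg max[OF st] by (simp add: \<Phi>_def K_def)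
  have bnd: "0 \<le> u" "u < v" "v \<le> 1"
    using z(1) pos by (auto simp: uv T_def \<Phi>_def order_less_le)
  define \<delta> where "\<delta> = v - u"
  define \<kappa> where "\<kappa> = K * (\<nu> * \<delta> powr (\<nu> - 1))"
  have \<delta>: "0 < \<delta>" "\<delta> \<le> 1" using bnd by (auto simp: \<delta>_def)
  have K: "0 \<le> K" using y1 by (simp add: K_def)
  have \<kappa>\<delta>: "\<kappa> * \<delta> = K * \<nu> * \<delta> powr \<nu>"
    using \<delta> by (simp add: \<kappa>_def powr_diff)
  \<comment> \<open>\<open>-m\<close> is the second derivative of \<open>K * x powr \<nu>\<close> at \<open>\<delta>\<close>.\<close>
  define m where "m = K * (\<nu> * ((1 - \<nu>) * \<delta> powr (\<nu> - 2)))"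
  have m: "0 \<le> m"
    unfolding m_def using K \<nu> by simp
  have powr_left: "((\<lambda>x. (v - x) powr r) has_real_derivative - (r * (v - x) powr (r - 1))) (at x)"
    if "x < v" for x r
    using that by (auto intro!: derivative_eq_intros)
  have powr_right: "((\<lambda>x. (x - u) powr r) has_real_derivative r * (x - u) powr (r - 1)) (at x)"
    if "u < x" for x r
    using that by (auto intro!: derivative_eq_intros)
  \<comment> \<open>For \<open>u > 0\<close> this is the equation at \<open>u\<close>, where \<open>\<Phi>\<close> is maximal in its first argument.\<close>
  have left: "(a + \<nu> - 1) * u * \<kappa> \<le> a * \<nu> * y u"
  proof (cases "u = 0")
    case True
    then show ?thesis using y0 a \<nu> by simp
  next
    case False
    let ?f = "\<lambda>x. \<Phi> (x, v)" and ?f' = "\<lambda>x. K * (\<nu> * (v - x) powr (\<nu> - 1)) - y' x"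
    have f'': "(?f' has_real_derivative m - y'' u) (at u)"
      using bnd unfolding m_def \<delta>_def
      by (auto intro!: derivative_eq_intros y'' powr_left simp: algebra_simps)
    have f': "(?f has_real_derivative ?f' x) (at x)" if "x < v" for x
      using that unfolding \<Phi>_def split
      by (auto intro!: derivative_eq_intros y' powr_left simp: algebra_simps)
    have "?f' u = 0 \<and> m - y'' u \<le> 0"
      using local_max_derivs[of 0 u v ?f ?f', OF _ _ _ _ f''] f' max bnd False by auto
    then have u': "y' u = \<kappa>" and "0 \<le> y'' u" using m by (auto simp: \<kappa>_def \<delta>_def)
    then have "0 \<le> (1 - u\<^sup>2) * y'' u"
      using bnd by (intro mult_nonneg_nonneg) (auto simp: power_le_one)
    then show ?thesis using ode[of u] unfolding u' by linarith
  qed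
  have "a * \<nu> * (y v - y u) \<le> a * \<nu> * (K * \<delta> powr \<nu>)"
  proof (cases "v = 1")
    case False
    let ?f = "\<lambda>x. \<Phi> (u, x)" and ?f' = "\<lambda>x. y' x - K * (\<nu> * (x - u) powr (\<nu> - 1))"
    have f'': "(?f' has_real_derivative y'' v + m) (at v)"
      using bnd unfolding m_def \<delta>_def
      by (auto intro!: derivative_eq_intros y'' powr_right simp: algebra_simps)
    have f': "(?f has_real_derivative ?f' x) (at x)" if "u < x" for x
      using that unfolding \<Phi>_def split
      by (auto intro!: derivative_eq_intros y' powr_right simp: algebra_simps)
    have "?f' v = 0 \<and> y'' v + m \<le> 0"
      using local_max_derivs[of u v 1 ?f ?f', OF _ _ _ _ f''] f' max bnd False by auto
    then have v': "y' v = \<kappa>" and "y'' v \<le> 0" using m by (auto simp: \<kappa>_def \<delta>_def)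
    then have "(1 - v\<^sup>2) * y'' v \<le> 0"
      using bnd by (intro mult_nonneg_nonpos) (auto simp: power_le_one)
    then have "a * \<nu> * y v \<le> (a + \<nu> - 1) * v * \<kappa>"
      using ode[of v] unfolding v' by linarith
    with left have "a * \<nu> * (y v - y u) \<le> (a + \<nu> - 1) * (\<kappa> * \<delta>)"
      by (simp add: \<delta>_def algebra_simps)
    also have "\<dots> \<le> a * (\<kappa> * \<delta>)"
      using \<nu> K by (intro mult_right_mono) (auto simp: \<kappa>\<delta>)
    finally show ?thesis unfolding \<kappa>\<delta> by (simp add: mult_ac)
  next
    case True
    have u: "u = 1 - \<delta>" using True by (simp add: \<delta>_def)
    \<comment> \<open>The equation is degenerate at \<open>1\<close> and \<open>\<Phi>\<close> need not be stationary there. With \<open>y v = K\<close> and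
      \<open>e = \<delta> powr (\<nu> - 1)\<close>, what is left to prove is \<open>a - (a + \<nu> - 1) (1 - \<delta>) e \<le> a e \<delta>\<close>, that is
      \<open>(1 - \<nu>) e (1 - \<delta>) \<le> a (e - 1)\<close>; as \<open>a \<ge> 1\<close>, the worst case is \<open>a = 1\<close>, which is Bernoulli's
      inequality divided by \<open>\<delta> powr (1 - \<nu>)\<close>.\<close>
    define e where "e = \<delta> powr (\<nu> - 1)"
    have e: "0 \<le> e" "e * \<delta> powr (1 - \<nu>) = 1" "\<delta> powr \<nu> = e * \<delta>"
      using \<delta> by (auto simp: e_def simp flip: powr_add) (simp add: powr_diff)
    have bern: "\<delta> powr (1 - \<nu>) \<le> 1 - (1 - \<nu>) * (1 - \<delta>)"
      using Youngs_inequality_0[of "1 - \<nu>" \<nu> \<delta> 1] \<delta> \<nu> by (simp add: algebra_simps)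
    have "1 \<le> e * (1 - (1 - \<nu>) * (1 - \<delta>))"
      using mult_left_mono[OF bern e(1)] e(2) by simp
    then have *: "(1 - \<nu>) * (e * (1 - \<delta>)) \<le> e - 1" by (simp add: algebra_simps)
    have "0 \<le> (1 - \<nu>) * (e * (1 - \<delta>))" using \<nu> e \<delta> by simp
    then have "1 * (e - 1) \<le> a * (e - 1)" using * a by (intro mult_right_mono) auto
    with * have "a - (a + \<nu> - 1) * (1 - \<delta>) * e \<le> a * (e * \<delta>)" by (simp add: algebra_simps)
    then have "K * \<nu> * (a - (a + \<nu> - 1) * (1 - \<delta>) * e) \<le> K * \<nu> * (a * (e * \<delta>))"
      using K \<nu> by (intro mult_left_mono) auto
    moreover have "a * \<nu> * (y v - y u) \<le> a * \<nu> * K - (a + \<nu> - 1) * (1 - \<delta>) * \<kappa>"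
      using left by (simp add: True K_def u algebra_simps)
    ultimately show ?thesis unfolding e(3) \<kappa>_def e_def[symmetric] by (simp add: algebra_simps)
  qed
  then have "y v - y u \<le> K * \<delta> powr \<nu>" using a \<nu> by simp
  then show False using pos by (simp add: \<Phi>_def \<delta>_def)
qed

text \<open>
  The equation says that \<open>y'\<close> is a constant multiple of \<open>(1 - x\<^sup>2) powr (b / 2)\<close> on \<open>[0, 1)\<close>.
\<close>

lemma increasing_of_ode:
  fixes y y' y'' :: "real \<Rightarrow> real" and b :: real
  assumes y': "\<And>x. (y has_real_derivative y' x) (at x)"
    and y'': "\<And>x. (y' has_real_derivative y'' x) (at x)"
    and ode: "\<And>x. (1 - x\<^sup>2) * y'' x + b * x * y' x = 0"
    and y'0: "0 \<le> y' 0"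
    and st: "0 \<le> s" "s \<le> t" "t \<le> 1"
  shows "y s \<le> y t"
proof -
  have sq: "x\<^sup>2 < 1" if "0 \<le> x" "x < 1" for x :: real
    using that by (simp add: power_less_one_iff)
  define h where "h = (\<lambda>x. y' x * (1 - x\<^sup>2) powr (- b / 2))"
  have h': "(h has_real_derivative 0) (at x)" if "0 \<le> x" "x < 1" for x
  proof -
    have "(h has_real_derivative y'' x * (1 - x\<^sup>2) powr (- b / 2)
        + y' x * (- b / 2 * (1 - x\<^sup>2) powr (- b / 2 - 1) * (- (2 * x)))) (at x)"
      unfolding h_def using sq[OF that]
      by (auto intro!: derivative_eq_intros y'')
    moreover have "(1 - x\<^sup>2) powr (- b / 2) = (1 - x\<^sup>2) * (1 - x\<^sup>2) powr (- b / 2 - 1)"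
      using sq[OF that] by (simp add: powr_mult_base)
    moreover have "y'' x * ((1 - x\<^sup>2) * w) + y' x * (- b / 2 * w * (- (2 * x)))
        = w * ((1 - x\<^sup>2) * y'' x + b * x * y' x)" for w
      by (simp add: algebra_simps)
    ultimately show ?thesis by (simp add: ode)
  qed
  have "0 \<le> y' x" if x: "0 \<le> x" "x < 1" for x
  proof -
    have "h x = h 0"
    proof (cases "x = 0")
      case False
      have "continuous_on {0..x} h"
        using DERIV_isCont[OF h'] x by (auto intro!: continuous_at_imp_continuous_on)
      then show ?thesis
        using DERIV_isconst_end[of 0 x h] h' x False by auto
    qed simp
    then have "0 \<le> y' x * (1 - x\<^sup>2) powr (- b / 2)" using y'0 by (simp add: h_def)
    moreover have "0 < (1 - x\<^sup>2) powr (- b / 2)" using sq[OF x] by simp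
    ultimately show ?thesis by (simp add: zero_le_mult_iff)
  qed
  then have "\<exists>w. (y has_real_derivative w) (at x) \<and> 0 \<le> w" if "s < x" "x < t" for x
    using y'[of x] st that by auto
  moreover have "continuous_on {s..t} y"
    using DERIV_isCont[OF y'] by (simp add: continuous_at_imp_continuous_on)
  ultimately show ?thesis
    using DERIV_nonneg_imp_increasing_open[of s t y] st by blast
qed

section \<open>The Hoelder constant\<close>

theorem theorem5p2:
  fixes p :: nat and \<nu> :: real
  assumes "0 \<le> \<nu>" and "\<nu> \<le> 1"
  shows "H p \<nu> \<le> ereal (\<Prod>i = 1..p. \<nu> + real i)"
proof -
  define q where "q = real p + \<nu>"
  have K: "g p q 1 = (\<Prod>i = 1..p. \<nu> + real i)"
    unfolding q_def by (rule g_shifted_at_1)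
  then have K0: "0 \<le> g p q 1" using assms by (simp add: prod_nonneg)
  have at0: "0 \<le> g p q 0" "0 \<le> deriv (g p q) 0"
    using g_at_0_nonneg[of p q] assms by (simp_all add: q_def)
  have "g p q t - g p q s \<le> g p q 1 * (t - s) powr \<nu>" if st: "0 \<le> s" "s < t" "t \<le> 1" for s t
  proof (cases "\<nu> = 0")
    case True
    have mono: "g p q x \<le> g p q x'" if "0 \<le> x" "x \<le> x'" "x' \<le> 1" for x x'
      using increasing_of_ode[OF g_DERIV g_DERIV2 _ at0(2), of "q - 1"] g_ode[of _ p q] that
      by (simp add: q_def True)
    show ?thesis using mono[of 0 s] mono[of t 1] at0(1) st by (simp add: True)
  next
    case False
    show ?thesis
    proof (cases "p = 0")
      case True
      then show ?thesis by simp
    next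
      case p: False
      have ode: "(1 - x\<^sup>2) * deriv (deriv (g p q)) x + (real p + \<nu> - 1) * x * deriv (g p q) x
          = real p * \<nu> * g p q x" for x
        using g_ode[of x p q] by (simp add: q_def algebra_simps)
      show ?thesis
        by (rule holder_of_ode[OF _ _ _ g_DERIV g_DERIV2 ode at0(1) K0]) (use assms False p st in auto)
    qed
  qed
  then show ?thesis
    unfolding H_def K[symmetric] q_def[symmetric]
    by (intro SUP_least) (auto simp: divide_le_eq)
qed

end
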